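(* Let $n\ge1$, let $a_0,\dots,a_{n-1}\in\mathbb{H}$, and let $$A_c=\begin{bmatrix}0&1&\cdots&0\\ \vdots&\vdots&\ddots&\vdots\\ 0&0&\cdots&1\\ -a_0&-a_1&\cdots&-a_{n-1}\end{bmatrix}\in\mathbb{H}^{n\times n}.$$ Then the companion polynomial $a(\lambda)=a_0+a_1\lambda+\cdots+a_{n-1}\lambda^{n-1}+\lambda^n\in\mathbb{H}[\lambda]$ of $A_c$ satisfies the right matrix evaluation identity $$a_0 I+a_1A_c+\cdots+a_{n-1}A_c^{n-1}+A_c^n=0.$$
   Context: $\mathbb{H}$ denotes the real quaternions (noncommutative). For $q\in\mathbb{H}$ and a matrix $M$ over $\mathbb{H}$, $qM$ is the matrix with entries $qM_{ij}$ (scalar multiplied on the left of each entry). The matrix $A_c$ has rows $e_i^{\top}A_c=e_{i+1}^{\top}$ for $i=1,\dots,n-1$ and last row $[-a_0,\dots,-a_{n-1}]$, where $e_i$ is the $i$-th canonical basis column vector. *)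

theory Defs
  imports Complex_Main "HOL-Computational_Algebra.Polynomial" "Jordan_Normal_Form.Matrix"
begin

datatype quat = Quat (qRe: real) (qI: real) (qJ: real) (qK: real)

lemma quat_eq_iff:
  "x = y \<longleftrightarrow> qRe x = qRe y \<and> qI x = qI y \<and> qJ x = qJ y \<and> qK x = qK y"
  by (auto intro: quat.expand)

instantiation quat :: division_ring
begin

definition zero_quat :: quat where
  "0 = Quat 0 0 0 0"

definition one_quat :: quat where
  "1 = Quat 1 0 0 0"

definition plus_quat :: "quat \<Rightarrow> quat \<Rightarrow> quat" where
  "x + y = Quat (qRe x + qRe y) (qI x + qI y) (qJ x + qJ y) (qK x + qK y)"

definition uminus_quat :: "quat \<Rightarrow> quat" where
  "- x = Quat (- qRe x) (- qI x) (- qJ x) (- qK x)"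

definition minus_quat :: "quat \<Rightarrow> quat \<Rightarrow> quat" where
  "x - y = Quat (qRe x - qRe y) (qI x - qI y) (qJ x - qJ y) (qK x - qK y)"

definition times_quat :: "quat \<Rightarrow> quat \<Rightarrow> quat" where
  "x * y = Quat
     (qRe x * qRe y - qI x * qI y - qJ x * qJ y - qK x * qK y)
     (qRe x * qI y + qI x * qRe y + qJ x * qK y - qK x * qJ y)
     (qRe x * qJ y - qI x * qK y + qJ x * qRe y + qK x * qI y)
     (qRe x * qK y + qI x * qJ y - qJ x * qI y + qK x * qRe y)"

definition inverse_quat :: "quat \<Rightarrow> quat" where
  "inverse x = (let N = (qRe x)\<^sup>2 + (qI x)\<^sup>2 + (qJ x)\<^sup>2 + (qK x)\<^sup>2
     in Quat (qRe x / N) (- qI x / N) (- qJ x / N) (- qK x / N))"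

definition divide_quat :: "quat \<Rightarrow> quat \<Rightarrow> quat" where
  "x div y = x * inverse y" for x y :: quat

instance
proof
  have N: "(qRe x)\<^sup>2 + (qI x)\<^sup>2 + (qJ x)\<^sup>2 + (qK x)\<^sup>2 \<noteq> 0" if "x \<noteq> 0" for x :: quat
    using that
    by (auto simp: quat_eq_iff zero_quat_def add_nonneg_eq_0_iff)
  show "inverse x * x = 1" if "x \<noteq> 0" for x :: quat
    using N[OF that]
    by (simp add: quat_eq_iff one_quat_def times_quat_def inverse_quat_def Let_def
        divide_simps) (simp add: algebra_simps power2_eq_square)
  show "x * inverse x = 1" if "x \<noteq> 0" for x :: quat
    using N[OF that]
    by (simp add: quat_eq_iff one_quat_def times_quat_def inverse_quat_def Let_def
        divide_simps) (simp add: algebra_simps power2_eq_square)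
qed (simp_all add: quat_eq_iff zero_quat_def one_quat_def plus_quat_def uminus_quat_def
    minus_quat_def times_quat_def inverse_quat_def divide_quat_def Let_def algebra_simps)

end

lemma quat_units:
  defines "i \<equiv> Quat 0 1 0 0" and "j \<equiv> Quat 0 0 1 0" and "k \<equiv> Quat 0 0 0 1"
  shows "i * i = -1" "j * j = -1" "k * k = -1"
    and "i * j = k" "j * k = i" "k * i = j"
    and "j * i = - k" "k * j = - i" "i * k = - j"
  by (simp_all add: i_def j_def k_def times_quat_def uminus_quat_def one_quat_def)

text \<open>Rows and columns are indexed from 0; only \<open>a 0, \<dots>, a (n - 1)\<close> are used.\<close>

definition companion_mat :: "nat \<Rightarrow> (nat \<Rightarrow> 'a::ring_1) \<Rightarrow> 'a mat" where
  "companion_mat n a = mat n n (\<lambda>(i, j).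
     if i = n - 1 then - a j else if j = i + 1 then 1 else 0)"

lemma row_companion_mat:
  assumes "i < n"
  shows "row (companion_mat n a) i =
    (if i = n - 1 then vec n (\<lambda>j. - a j) else unit_vec n (i + 1))"
  using assms by (auto simp: companion_mat_def unit_vec_def)

definition companion_poly :: "nat \<Rightarrow> (nat \<Rightarrow> 'a::ring_1) \<Rightarrow> 'a poly" where
  "companion_poly n a = (\<Sum>k<n. monom (a k) k) + monom 1 n"

text \<open>Right evaluation at a square matrix: powers of \<open>A\<close> stand to the right of the coefficients,
  i.e. \<open>p\<close> is mapped to the sum of the \<open>p\<^sub>k A\<^sup>k\<close>.  \<^const>\<open>smult_mat\<close> multiplies each entry by
  the scalar on the left, so this is meaningful over a noncommutative ring.\<close>

definition right_mat_eval :: "'a::ring_1 poly \<Rightarrow> 'a mat \<Rightarrow> 'a mat" where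
  "right_mat_eval p A =
     (\<Oplus>\<^bsub>ring_mat TYPE('a) (dim_row A) ()\<^esub> k \<in> {..degree p}. coeff p k \<cdot>\<^sub>m A ^\<^sub>m k)"

end

theory Submission
  imports Defs
begin

text \<open>Left multiplication of a row vector by a scalar commutes with right multiplication by a
  matrix. As the row \<open>e\<^sub>i\<close> of the identity equals \<open>e\<^sub>0 A\<^sup>i\<close>, row \<open>i\<close> of \<open>\<Sum>\<^sub>k c\<^sub>k A\<^sup>k\<close> is
  \<open>(\<Sum>\<^sub>k c\<^sub>k e\<^sub>0 A\<^sup>k) A\<^sup>i\<close>, and the bracket vanishes because \<open>e\<^sub>0 A\<^sup>k = e\<^sub>k\<close> for \<open>k < n\<close>
  and \<open>e\<^sub>0 A\<^sup>n\<close> is the last row of \<open>A\<close>.\<close>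

text \<open>Turns the carrier-based sum of matrices into ordinary sums of entries, so that the rest
  of the argument takes place in the coefficient ring.\<close>

lemma finsum_ring_mat:
  fixes f :: "'b \<Rightarrow> 'a::semiring_1 mat"
  assumes "finite S" and "\<And>k. k \<in> S \<Longrightarrow> f k \<in> carrier_mat n n"
  shows "(\<Oplus>\<^bsub>ring_mat TYPE('a) n ()\<^esub> k \<in> S. f k) = mat n n (\<lambda>(i, j). \<Sum>k\<in>S. f k $$ (i, j))"
proof -
  \<comment> \<open>The rule \<open>R.finsum_insert\<close> comes from this locale; square matrices
    already form an abelian monoid under addition when the entries lie in a semiring.\<close>
  interpret R: abelian_monoid "ring_mat TYPE('a) n ()"
    by (rule abelian_monoidI) (auto simp: ring_mat_simps assoc_add_mat comm_add_mat)
  from assms show ?thesis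
  proof (induction S)
    case empty
    then show ?case by (simp add: ring_mat_simps) auto
  next
    case (insert x F)
    have "f k \<in> carrier (ring_mat TYPE('a) n ())" if "k \<in> insert x F" for k
      using insert.prems that by (simp add: ring_mat_simps)
    then have "(\<Oplus>\<^bsub>ring_mat TYPE('a) n ()\<^esub> k \<in> insert x F. f k)
        = f x + (\<Oplus>\<^bsub>ring_mat TYPE('a) n ()\<^esub> k \<in> F. f k)"
      using insert.hyps by (subst R.finsum_insert) (auto simp: ring_mat_simps)
    then show ?case
      using insert by (auto intro!: eq_matI)
  qed
qed

lemma pow_mat_add:
  fixes A :: "'a::semiring_1 mat"
  assumes "A \<in> carrier_mat n n"
  shows "A ^\<^sub>m (k + l) = A ^\<^sub>m k * A ^\<^sub>m l"
proof (induction l)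
  case 0
  then show ?case using assms by simp
next
  case (Suc l)
  then show ?case using assms by (simp add: assoc_mult_mat[where ?n\<^sub>1 = n and ?n\<^sub>2 = n and ?n\<^sub>3 = n and ?n\<^sub>4 = n])
qed

lemma companion_mat_carrier [simp]: "companion_mat n a \<in> carrier_mat n n"
  by (simp add: companion_mat_def)

lemma dim_companion_mat [simp]:
  "dim_row (companion_mat n a) = n" "dim_col (companion_mat n a) = n"
  by (simp_all add: companion_mat_def)

lemma index_mult_mat_sum:
  assumes "A \<in> carrier_mat n m" "B \<in> carrier_mat m p" "i < n" "j < p"
  shows "(A * B) $$ (i, j) = (\<Sum>l<m. A $$ (i, l) * B $$ (l, j))"
  using assms by (auto simp: scalar_prod_def lessThan_atLeast0 intro!: sum.cong)

lemma companion_mat_pow_row_0: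
  assumes "k < n" "j < n"
  shows "(companion_mat n a ^\<^sub>m k) $$ (0, j) = (if j = k then 1 else 0)"
  using assms
proof (induction k arbitrary: j)
  case 0
  then show ?case by (simp add: companion_mat_def)
next
  case (Suc k)
  have "(companion_mat n a ^\<^sub>m Suc k) $$ (0, j)
      = (\<Sum>l<n. (companion_mat n a ^\<^sub>m k) $$ (0, l) * companion_mat n a $$ (l, j))"
    using Suc.prems by (simp add: index_mult_mat_sum[where n = n and m = n and p = n] del: index_mult_mat)
  also have "\<dots> = (\<Sum>l<n. if l = k then companion_mat n a $$ (l, j) else 0)"
    using Suc by (intro sum.cong) auto
  also have "\<dots> = companion_mat n a $$ (k, j)"
    using Suc.prems by simp
  \<comment> \<open>Since \<open>Suc k < n\<close>, row \<open>k\<close> is not the last row, hence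
    it is a shifted unit row.\<close>
  also have "\<dots> = (if j = Suc k then 1 else 0)"
    using Suc.prems by (auto simp: companion_mat_def)
  finally show ?case .
qed

text \<open>In the product \<open>A ^\<^sub>m i * A ^\<^sub>m k\<close>, row 0 of the left factor is
  a unit row and selects row \<open>i\<close> of the right factor.\<close>

lemma companion_mat_pow_row:
  assumes "i < n" "j < n"
  shows "(companion_mat n a ^\<^sub>m k) $$ (i, j) = (companion_mat n a ^\<^sub>m (i + k)) $$ (0, j)"
proof -
  let ?A = "companion_mat n a"
  have "(?A ^\<^sub>m (i + k)) $$ (0, j) = (\<Sum>l<n. (?A ^\<^sub>m i) $$ (0, l) * (?A ^\<^sub>m k) $$ (l, j))"
    using assms by (simp add: pow_mat_add[where n = n]
        index_mult_mat_sum[where n = n and m = n and p = n] del: index_mult_mat)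
  also have "\<dots> = (\<Sum>l<n. if l = i then (?A ^\<^sub>m k) $$ (l, j) else 0)"
    using assms by (intro sum.cong) (auto simp: companion_mat_pow_row_0)
  finally show ?thesis using assms by simp
qed

lemma companion_mat_pow_n_row_0:
  assumes "j < n"
  shows "(companion_mat n a ^\<^sub>m n) $$ (0, j) = - a j"
proof -
  \<comment> \<open>Row shift with \<open>i = n - 1\<close> and \<open>k = 1\<close>;
    \<open>j < n\<close> forces \<open>n > 0\<close>, so the exponents add up to
    \<open>n\<close>.\<close>
  have "(companion_mat n a ^\<^sub>m n) $$ (0, j) = (companion_mat n a ^\<^sub>m 1) $$ (n - 1, j)"
    using assms by (subst companion_mat_pow_row) auto
  then show ?thesis using assms by (simp add: companion_mat_def)
qed

lemma companion_mat_annihilated: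
  fixes a :: "nat \<Rightarrow> 'a::ring_1"
  assumes "i < n" "j < n"
  shows "(\<Sum>k<n. a k * (companion_mat n a ^\<^sub>m k) $$ (i, j)) + (companion_mat n a ^\<^sub>m n) $$ (i, j) = 0"
proof -
  let ?A = "companion_mat n a"
  \<comment> \<open>The exponent \<open>i + k\<close> is split in the order \<open>k + i\<close>:
    the factor \<open>A ^\<^sub>m i\<close>, common to all \<open>k\<close>, then stands on the
    right, away from the coefficients \<open>a k\<close>.\<close>
  have row: "(?A ^\<^sub>m k) $$ (i, j) = (\<Sum>l<n. (?A ^\<^sub>m k) $$ (0, l) * (?A ^\<^sub>m i) $$ (l, j))" for k
    using assms by (simp add: companion_mat_pow_row[of i] add.commute[of i] pow_mat_add[where n = n]
        index_mult_mat_sum[where n = n and m = n and p = n] del: index_mult_mat)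
  \<comment> \<open>The sum picks out \<open>a l\<close>, which cancels the entry
    \<open>- a l\<close> of row 0 of \<open>A ^\<^sub>m n\<close>.\<close>
  have row_0: "(\<Sum>k<n. a k * (?A ^\<^sub>m k) $$ (0, l)) + (?A ^\<^sub>m n) $$ (0, l) = 0" if "l < n" for l
  proof -
    have "(\<Sum>k<n. a k * (?A ^\<^sub>m k) $$ (0, l)) = (\<Sum>k<n. if k = l then a k else 0)"
      using that by (intro sum.cong) (auto simp: companion_mat_pow_row_0)
    then show ?thesis using that by (simp add: companion_mat_pow_n_row_0)
  qed
  have "(\<Sum>k<n. a k * (?A ^\<^sub>m k) $$ (i, j)) + (?A ^\<^sub>m n) $$ (i, j)
      = (\<Sum>k<n. \<Sum>l<n. a k * (?A ^\<^sub>m k) $$ (0, l) * (?A ^\<^sub>m i) $$ (l, j))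
        + (\<Sum>l<n. (?A ^\<^sub>m n) $$ (0, l) * (?A ^\<^sub>m i) $$ (l, j))"
    by (simp only: row sum_distrib_left mult.assoc)
  also have "\<dots> = (\<Sum>l<n. ((\<Sum>k<n. a k * (?A ^\<^sub>m k) $$ (0, l)) + (?A ^\<^sub>m n) $$ (0, l)) * (?A ^\<^sub>m i) $$ (l, j))"
    \<comment> \<open>The common right factor is pulled out by distributivity alone; no two ring
      elements are commuted.\<close>
    by (subst sum.swap) (simp add: sum_distrib_right distrib_right sum.distrib)
  also have "\<dots> = 0"
    by (intro sum.neutral) (simp add: row_0)
  finally show ?thesis .
qed

lemma coeff_companion_poly:
  "coeff (companion_poly n a) k = (if k < n then a k else if k = n then 1 else 0)"
  by (auto simp: companion_poly_def coeff_sum)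

lemma degree_companion_poly: "degree (companion_poly n a) = n"
  by (intro antisym degree_le le_degree) (auto simp: coeff_companion_poly)

text \<open>The polynomial is monic of degree exactly \<open>n\<close>, so the evaluation runs over
  \<open>{..n}\<close> and its top term is \<open>A ^\<^sub>m n\<close> with coefficient 1.\<close>

lemma right_mat_eval_companion_poly:
  fixes A :: "'a::ring_1 mat"
  assumes "A \<in> carrier_mat n n"
  shows "right_mat_eval (companion_poly n a) A
    = (\<Oplus>\<^bsub>ring_mat TYPE('a) n ()\<^esub> k \<in> {..<n}. a k \<cdot>\<^sub>m A ^\<^sub>m k) + A ^\<^sub>m n"
  using assms
  by (auto simp: right_mat_eval_def degree_companion_poly coeff_companion_poly finsum_ring_mat
      lessThan_Suc_atMost[symmetric] intro!: eq_matI)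

theorem theorem2:
  fixes n :: nat and a :: "nat \<Rightarrow> quat"
  assumes "n \<ge> 1"
  defines "A \<equiv> companion_mat n a"
  shows "right_mat_eval (companion_poly n a) A
           = (\<Oplus>\<^bsub>ring_mat TYPE(quat) n ()\<^esub> k \<in> {..<n}. a k \<cdot>\<^sub>m A ^\<^sub>m k) + A ^\<^sub>m n
       \<and> (\<Oplus>\<^bsub>ring_mat TYPE(quat) n ()\<^esub> k \<in> {..<n}. a k \<cdot>\<^sub>m A ^\<^sub>m k) + A ^\<^sub>m n = 0\<^sub>m n n"
proof
  have A: "A \<in> carrier_mat n n" by (simp add: A_def)
  show "right_mat_eval (companion_poly n a) A
      = (\<Oplus>\<^bsub>ring_mat TYPE(quat) n ()\<^esub> k \<in> {..<n}. a k \<cdot>\<^sub>m A ^\<^sub>m k) + A ^\<^sub>m n"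
    using A by (rule right_mat_eval_companion_poly)
  show "(\<Oplus>\<^bsub>ring_mat TYPE(quat) n ()\<^esub> k \<in> {..<n}. a k \<cdot>\<^sub>m A ^\<^sub>m k) + A ^\<^sub>m n = 0\<^sub>m n n"
    using A companion_mat_annihilated[of _ n _ a]
    by (intro eq_matI) (auto simp: finsum_ring_mat A_def)
qed

end
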